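(* Let $d\ge 1$ and $A\subset[0,1]^d$. Let $\mathcal{K}_A=\{E\in\mathcal{K}([0,1]^d): E\cap A\neq\emptyset\}$. Then $A$ is nowhere dense in $[0,1]^d$ if and only if $\mathcal{K}_A$ is nowhere dense in $(\mathcal{K}([0,1]^d),d_H)$.
   Context: $\mathcal{K}([0,1]^d)$ denotes the set of all nonempty compact subsets of $[0,1]^d$ with the Hausdorff metric $d_H(E,F)=\inf\{\varepsilon>0: E\subset F^\varepsilon \text{ and } F\subset E^\varepsilon\}$, where $E^\varepsilon=\{x\in\mathbb{R}^d:\operatorname{dist}(x,E)<\varepsilon\}$. A subset of a metric space is nowhere dense if its closure in that space has empty interior. *)

theory Defs
  imports "HOL-Analysis.Analysis"
begin

definition nowhere_dense_in :: "'a topology \<Rightarrow> 'a set \<Rightarrow> bool" where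
  "nowhere_dense_in X S \<longleftrightarrow> S \<subseteq> topspace X \<and> X interior_of (X closure_of S) = {}"

definition compacts_in :: "'a::metric_space set \<Rightarrow> 'a set set" where
  "compacts_in S = {E. E \<subseteq> S \<and> E \<noteq> {} \<and> compact E}"

text \<open>Only meaningful for \<open>E \<noteq> {}\<close>, because \<open>infdist x {} = 0\<close>.\<close>

definition open_thickening :: "'a::metric_space set \<Rightarrow> real \<Rightarrow> 'a set" where
  "open_thickening E \<epsilon> = {x. infdist x E < \<epsilon>}"

text \<open>
  The value \<open>0\<close> outside the nonempty compact sets is a dummy: the locale \<open>Metric_space\<close> requires
  nonnegativity and symmetry on the whole type, not just on the carrier.
\<close>

definition hausdorff_dist :: "'a::metric_space set \<Rightarrow> 'a set \<Rightarrow> real" where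
  "hausdorff_dist E F =
     (if E \<in> compacts_in UNIV \<and> F \<in> compacts_in UNIV
      then Inf {\<epsilon>. \<epsilon> > 0 \<and> E \<subseteq> open_thickening F \<epsilon> \<and> F \<subseteq> open_thickening E \<epsilon>}
      else 0)"

lemma hausdorff_dist_set_nonempty:
  fixes E F :: "'a::metric_space set"
  assumes "E \<in> compacts_in UNIV" "F \<in> compacts_in UNIV"
  shows "{\<epsilon>. \<epsilon> > 0 \<and> E \<subseteq> open_thickening F \<epsilon> \<and> F \<subseteq> open_thickening E \<epsilon>} \<noteq> {}"
proof -
  obtain a b where ab: "a \<in> E" "b \<in> F" using assms by (auto simp: compacts_in_def)
  have "bounded (E \<union> F)" using assms by (auto simp: compacts_in_def compact_imp_bounded)
  then obtain e where e: "\<And>x y. x \<in> E \<union> F \<Longrightarrow> y \<in> E \<union> F \<Longrightarrow> dist x y \<le> e"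
    by (meson bounded_two_points)
  have "e \<ge> 0" using e[of a a] ab by auto
  moreover have "E \<subseteq> open_thickening F (e + 1)"
  proof
    fix x assume "x \<in> E"
    then have "infdist x F \<le> e" using ab e by (intro infdist_le2[of b]) auto
    then show "x \<in> open_thickening F (e + 1)" by (simp add: open_thickening_def)
  qed
  moreover have "F \<subseteq> open_thickening E (e + 1)"
  proof
    fix x assume "x \<in> F"
    then have "infdist x E \<le> e" using ab e by (intro infdist_le2[of a]) auto
    then show "x \<in> open_thickening E (e + 1)" by (simp add: open_thickening_def)
  qed
  ultimately have "e + 1 \<in> {\<epsilon>. \<epsilon> > 0 \<and> E \<subseteq> open_thickening F \<epsilon> \<and> F \<subseteq> open_thickening E \<epsilon>}"
    by simp
  then show ?thesis by blast
qed

lemma hausdorff_dist_nonneg: "0 \<le> hausdorff_dist E F"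
proof (cases "E \<in> compacts_in UNIV \<and> F \<in> compacts_in UNIV")
  case True
  then show ?thesis
    unfolding hausdorff_dist_def using hausdorff_dist_set_nonempty[of E F]
    by (auto intro!: cInf_greatest)
qed (auto simp: hausdorff_dist_def)

lemma hausdorff_dist_commute: "hausdorff_dist E F = hausdorff_dist F E"
  unfolding hausdorff_dist_def by (simp add: conj_commute)

lemma hausdorff_dist_le:
  assumes "E \<in> compacts_in UNIV" "F \<in> compacts_in UNIV"
    and "\<epsilon> > 0" "E \<subseteq> open_thickening F \<epsilon>" "F \<subseteq> open_thickening E \<epsilon>"
  shows "hausdorff_dist E F \<le> \<epsilon>"
proof -
  have "Inf {\<epsilon>. \<epsilon> > 0 \<and> E \<subseteq> open_thickening F \<epsilon> \<and> F \<subseteq> open_thickening E \<epsilon>} \<le> \<epsilon>"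
    using assms by (intro cInf_lower bdd_belowI[of _ 0]) auto
  then show ?thesis using assms by (simp add: hausdorff_dist_def)
qed

lemma hausdorff_dist_less_imp:
  assumes "E \<in> compacts_in UNIV" "F \<in> compacts_in UNIV" "hausdorff_dist E F < \<epsilon>"
  shows "E \<subseteq> open_thickening F \<epsilon>" "F \<subseteq> open_thickening E \<epsilon>"
proof -
  have "Inf {\<epsilon>. \<epsilon> > 0 \<and> E \<subseteq> open_thickening F \<epsilon> \<and> F \<subseteq> open_thickening E \<epsilon>} < \<epsilon>"
    using assms by (simp add: hausdorff_dist_def)
  then obtain \<delta> where "\<delta> < \<epsilon>" "E \<subseteq> open_thickening F \<delta>" "F \<subseteq> open_thickening E \<delta>"
    using cInf_lessD[OF hausdorff_dist_set_nonempty[OF assms(1,2)]] by blast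
  then show "E \<subseteq> open_thickening F \<epsilon>" "F \<subseteq> open_thickening E \<epsilon>"
    by (auto simp: open_thickening_def subset_iff intro: less_trans)
qed

lemma open_thickening_trans:
  assumes "F \<noteq> {}" "E \<subseteq> open_thickening F r" "F \<subseteq> open_thickening G s"
  shows "E \<subseteq> open_thickening G (r + s)"
proof
  fix x assume "x \<in> E"
  then have "infdist x F < r" using assms by (auto simp: open_thickening_def)
  then have "(INF a\<in>F. dist x a) < r" using assms by (simp add: infdist_notempty)
  then obtain y where y: "y \<in> F" "dist x y < r"
    using cInf_lessD[of "dist x ` F" r] assms(1) by auto
  then have "infdist y G < s" using assms by (auto simp: open_thickening_def)
  then have "infdist x G < r + s" using infdist_triangle[of x G y] y by linarith
  then show "x \<in> open_thickening G (r + s)" by (simp add: open_thickening_def)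
qed

lemma hausdorff_dist_zero_subset:
  assumes "E \<in> compacts_in UNIV" "F \<in> compacts_in UNIV" "hausdorff_dist E F = 0"
  shows "E \<subseteq> F"
proof
  fix x assume x: "x \<in> E"
  have "infdist x F < \<epsilon>" if "\<epsilon> > 0" for \<epsilon>
    using hausdorff_dist_less_imp(1)[of E F \<epsilon>] assms that x by (auto simp: open_thickening_def)
  then have "infdist x F = 0"
    using infdist_nonneg[of x F] by (metis less_irrefl order_le_less)
  then show "x \<in> F"
    using assms in_closed_iff_infdist_zero[of F x] by (auto simp: compacts_in_def compact_imp_closed)
qed

lemma Metric_space_hausdorff: "Metric_space (compacts_in S) hausdorff_dist"
proof
  have mono: "E \<in> compacts_in UNIV" if "E \<in> compacts_in S" for E
    using that by (auto simp: compacts_in_def)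
  fix E F G :: "'a set"
  show "0 \<le> hausdorff_dist E F" by (rule hausdorff_dist_nonneg)
  show "hausdorff_dist E F = hausdorff_dist F E" by (rule hausdorff_dist_commute)
  show "hausdorff_dist E F = 0 \<longleftrightarrow> E = F" if "E \<in> compacts_in S" "F \<in> compacts_in S"
  proof
    assume "hausdorff_dist E F = 0"
    then show "E = F"
      using hausdorff_dist_zero_subset[of E F] hausdorff_dist_zero_subset[of F E]
        hausdorff_dist_commute[of E F] mono that by auto
  next
    assume "E = F"
    have "hausdorff_dist E E \<le> \<epsilon>" if "\<epsilon> > 0" for \<epsilon>
      using that mono \<open>E \<in> compacts_in S\<close>
      by (intro hausdorff_dist_le) (auto simp: open_thickening_def)
    then have "hausdorff_dist E E \<le> 0" by (meson dense_ge)
    then show "hausdorff_dist E F = 0"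
      using hausdorff_dist_nonneg[of E E] \<open>E = F\<close> by simp
  qed
  show "hausdorff_dist E G \<le> hausdorff_dist E F + hausdorff_dist F G"
    if "E \<in> compacts_in S" "F \<in> compacts_in S" "G \<in> compacts_in S"
  proof (rule field_le_epsilon)
    fix e :: real assume "e > 0"
    define r where "r = hausdorff_dist E F + e / 2"
    define s where "s = hausdorff_dist F G + e / 2"
    have "E \<subseteq> open_thickening F r" "F \<subseteq> open_thickening E r"
      using hausdorff_dist_less_imp[of E F r] mono that \<open>e > 0\<close> by (auto simp: r_def)
    moreover have "F \<subseteq> open_thickening G s" "G \<subseteq> open_thickening F s"
      using hausdorff_dist_less_imp[of F G s] mono that \<open>e > 0\<close> by (auto simp: s_def)
    moreover have "F \<noteq> {}" using that by (simp add: compacts_in_def)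
    ultimately have "E \<subseteq> open_thickening G (r + s)" "G \<subseteq> open_thickening E (s + r)"
      by (simp_all add: open_thickening_trans[of F])
    moreover have "r + s > 0"
      using \<open>e > 0\<close> hausdorff_dist_nonneg[of E F] hausdorff_dist_nonneg[of F G]
      by (simp add: r_def s_def)
    ultimately have "hausdorff_dist E G \<le> r + s"
      using mono that by (intro hausdorff_dist_le) (auto simp: add.commute)
    then show "hausdorff_dist E G \<le> hausdorff_dist E F + hausdorff_dist F G + e"
      by (simp add: r_def s_def)
  qed
qed

definition hausdorff_topology :: "'a::metric_space set \<Rightarrow> 'a set topology" where
  "hausdorff_topology S = Metric_space.mtopology (compacts_in S) hausdorff_dist"

lemma topspace_hausdorff_topology [simp]: "topspace (hausdorff_topology S) = compacts_in S"
  unfolding hausdorff_topology_def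
  by (rule Metric_space.topspace_mtopology[OF Metric_space_hausdorff])

end

theory Submission
  imports Defs
begin

text \<open>
  In a metric space, a set is nowhere dense iff every ball contains the centre of a smaller ball
  missing the set. If \<open>A\<close> is nowhere dense and \<open>E\<close> is compact, move each point of a finite net
  of \<open>E\<close> to a nearby point some ball around which misses \<open>A\<close>: the resulting finite set is close
  to \<open>E\<close>, and all compact sets close enough to it miss \<open>A\<close>. Conversely, if a compact \<open>F\<close> close
  to \<open>{x}\<close> has a Hausdorff ball of radius \<open>s\<close> without sets meeting \<open>A\<close>, then no point of \<open>A\<close> is
  within \<open>s\<close> of a point of \<open>F\<close>, since such a point could be added to \<open>F\<close>.
\<close>

text \<open>A point is outside the closure exactly when some ball around it misses \<open>A\<close>,
  and the interior of the closure is empty exactly when the closure contains no ball.\<close>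

lemma (in Metric_space) nowhere_dense_in_mtopology:
  "nowhere_dense_in mtopology A \<longleftrightarrow>
     A \<subseteq> M \<and> (\<forall>x\<in>M. \<forall>r>0. \<exists>y\<in>mball x r. \<exists>s>0. mball y s \<inter> A = {})"
proof -
  have outside: "y \<notin> mtopology closure_of A \<longleftrightarrow> (\<exists>s>0. mball y s \<inter> A = {})" if "y \<in> M" for y
    using that by (auto simp: metric_closure_of disjoint_iff)
  have "mtopology interior_of (mtopology closure_of A) = {} \<longleftrightarrow>
      (\<forall>x\<in>M. \<forall>r>0. \<not> mball x r \<subseteq> mtopology closure_of A)"
    by (auto simp: metric_interior_of)
  also have "\<dots> \<longleftrightarrow> (\<forall>x\<in>M. \<forall>r>0. \<exists>y\<in>mball x r. \<exists>s>0. mball y s \<inter> A = {})"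
    using outside mball_subset_mspace by (meson subset_iff)
  finally show ?thesis
    by (simp add: nowhere_dense_in_def)
qed

lemma nowhere_dense_in_top_of_set:
  fixes S :: "'a::metric_space set"
  shows "nowhere_dense_in (top_of_set S) A \<longleftrightarrow>
    A \<subseteq> S \<and> (\<forall>x\<in>S. \<forall>r>0. \<exists>y\<in>S. dist x y < r \<and> (\<exists>s>0. S \<inter> ball y s \<inter> A = {}))"
proof -
  \<comment> \<open>The subspace topology is the metric topology of the restricted distance, whose
    balls are the traces \<open>S \<inter> ball y s\<close>.\<close>
  interpret Submetric UNIV dist S
    by unfold_locales auto
  have "top_of_set S = sub.mtopology"
    by (simp add: mtopology_submetric)
  moreover have "sub.mball y s = S \<inter> ball y s" if "y \<in> S" for y s
    using that by auto
  ultimately show ?thesis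
    by (simp add: sub.nowhere_dense_in_mtopology Bex_def conj_ac cong: conj_cong)
qed

lemma nowhere_dense_in_hausdorff_topology:
  "nowhere_dense_in (hausdorff_topology S) \<A> \<longleftrightarrow>
    \<A> \<subseteq> compacts_in S \<and>
    (\<forall>E\<in>compacts_in S. \<forall>r>0. \<exists>F\<in>compacts_in S. hausdorff_dist E F < r \<and>
       (\<exists>s>0. \<forall>G\<in>compacts_in S. hausdorff_dist F G < s \<longrightarrow> G \<notin> \<A>))"
proof -
  interpret Metric_space "compacts_in S" hausdorff_dist
    by (rule Metric_space_hausdorff)
  have "mball F s \<inter> \<A> = {} \<longleftrightarrow> (\<forall>G\<in>compacts_in S. hausdorff_dist F G < s \<longrightarrow> G \<notin> \<A>)"
    if "F \<in> compacts_in S" for F s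
    using that by auto
  then show ?thesis
    unfolding hausdorff_topology_def nowhere_dense_in_mtopology
    by (simp add: Bex_def conj_ac cong: conj_cong)
qed

lemma compacts_in_imp_compacts_in_UNIV: "E \<in> compacts_in S \<Longrightarrow> E \<in> compacts_in UNIV"
  by (simp add: compacts_in_def)

lemma in_open_thickeningI: "y \<in> E \<Longrightarrow> dist x y < \<epsilon> \<Longrightarrow> x \<in> open_thickening E \<epsilon>"
  unfolding open_thickening_def using infdist_le[of y E x] by simp

text \<open>An infimum below \<open>\<epsilon>\<close> has a witness below
  \<open>\<epsilon>\<close>; nonemptiness excludes the default
  \<open>infdist x {} = 0\<close>.\<close>

lemma in_open_thickeningE:
  assumes "x \<in> open_thickening E \<epsilon>" "E \<noteq> {}"
  obtains y where "y \<in> E" "dist x y < \<epsilon>"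
  using assms cInf_lessD[of "dist x ` E" \<epsilon>]
  by (auto simp: open_thickening_def infdist_notempty)

text \<open>This turns a point \<open>a\<close> near \<open>F\<close> into a compact set near
  \<open>F\<close> that contains \<open>a\<close>.\<close>

lemma hausdorff_dist_insert_le:
  assumes F: "F \<in> compacts_in UNIV" and f: "f \<in> F" and t: "dist f a < t"
  shows "hausdorff_dist F (insert a F) \<le> t"
proof (rule hausdorff_dist_le)
  have "0 < t"
    using t by (meson le_less_trans zero_le_dist)
  then show "0 < t" "F \<subseteq> open_thickening (insert a F) t"
    by (auto intro: in_open_thickeningI)
  show "insert a F \<in> compacts_in UNIV"
    using F by (simp add: compacts_in_def)
  show "insert a F \<subseteq> open_thickening F t"
    using f t \<open>0 < t\<close> by (auto intro: in_open_thickeningI simp: dist_commute)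
qed (rule F)

text \<open>Finiteness of the perturbed net makes it compact and also yields one radius
  \<open>s\<close> valid at all its points.\<close>

lemma compact_imp_finite_approximation_avoiding:
  fixes S :: "'a::metric_space set"
  assumes A: "nowhere_dense_in (top_of_set S) A" and E: "E \<in> compacts_in S" and "0 < r"
  obtains F s where "F \<in> compacts_in S" "hausdorff_dist E F < r" "0 < s"
    "\<And>f. f \<in> F \<Longrightarrow> S \<inter> ball f s \<inter> A = {}"
proof -
  have E': "compact E" "E \<subseteq> S" "E \<noteq> {}"
    using E by (auto simp: compacts_in_def)
  have "\<exists>y s. y \<in> S \<and> dist x y < r/3 \<and> 0 < s \<and> S \<inter> ball y s \<inter> A = {}" if "x \<in> S" for x
    using A that \<open>0 < r\<close> unfolding nowhere_dense_in_top_of_set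
    by (meson divide_pos_pos zero_less_numeral)
  then obtain p \<sigma> where p: "\<And>x. x \<in> S \<Longrightarrow> p x \<in> S" "\<And>x. x \<in> S \<Longrightarrow> dist x (p x) < r/3"
    and \<sigma>: "\<And>x. x \<in> S \<Longrightarrow> 0 < \<sigma> x" "\<And>x. x \<in> S \<Longrightarrow> S \<inter> ball (p x) (\<sigma> x) \<inter> A = {}"
    by metis
  \<comment> \<open>Total boundedness gives a net inside \<open>E\<close> itself, so that the moved
    points stay close to \<open>E\<close>.\<close>
  obtain N where N: "finite N" "N \<subseteq> E" "E \<subseteq> (\<Union>x\<in>N. ball x (r/3))"
    using \<open>0 < r\<close> compact_imp_seq_compact[OF E'(1)] seq_compact_imp_totally_bounded[of E]
    by (metis divide_pos_pos zero_less_numeral)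
  have "N \<noteq> {}" "N \<subseteq> S"
    using N E' by auto
  define F where "F = p ` N"
  define s where "s = Min (\<sigma> ` N)"
  have F: "F \<in> compacts_in S"
    using N(1) \<open>N \<noteq> {}\<close> \<open>N \<subseteq> S\<close> p by (auto simp: F_def compacts_in_def finite_imp_compact)
  \<comment> \<open>One third of \<open>r\<close> pays for the net, one third for the move
    \<open>p\<close>; the last third makes the final bound strict.\<close>
  have "hausdorff_dist E F \<le> 2 * r / 3"
  proof (rule hausdorff_dist_le)
    show "E \<subseteq> open_thickening F (2 * r / 3)"
    proof
      fix e assume "e \<in> E"
      then obtain x where x: "x \<in> N" "dist x e < r/3"
        using N by auto
      moreover have "dist x (p x) < r/3"
        using p x \<open>N \<subseteq> S\<close> by auto
      ultimately have "dist e (p x) < 2 * r / 3"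
        using dist_triangle[of e "p x" x] by (simp add: dist_commute)
      then show "e \<in> open_thickening F (2 * r / 3)"
        using x by (auto simp: F_def intro: in_open_thickeningI)
    qed
    show "F \<subseteq> open_thickening E (2 * r / 3)"
    proof
      fix f assume "f \<in> F"
      then obtain x where x: "x \<in> N" "f = p x"
        by (auto simp: F_def)
      then have "dist f x < r/3"
        using p \<open>N \<subseteq> S\<close> by (auto simp: dist_commute)
      then show "f \<in> open_thickening E (2 * r / 3)"
        using x N \<open>0 < r\<close> by (intro in_open_thickeningI[of x]) auto
    qed
  qed (use E F \<open>0 < r\<close> in \<open>auto intro: compacts_in_imp_compacts_in_UNIV\<close>)
  then have "hausdorff_dist E F < r"
    using \<open>0 < r\<close> by linarith
  moreover have "0 < s"
    using N(1) \<open>N \<noteq> {}\<close> \<open>N \<subseteq> S\<close> \<sigma> by (auto simp: s_def)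
  moreover have "S \<inter> ball f s \<inter> A = {}" if f: "f \<in> F" for f
  proof -
    obtain x where x: "x \<in> N" "f = p x"
      using f by (auto simp: F_def)
    then have "s \<le> \<sigma> x"
      using N(1) by (simp add: s_def)
    then show ?thesis
      using \<sigma>(2)[of x] x \<open>N \<subseteq> S\<close> subset_ball[of s "\<sigma> x" f] by blast
  qed
  ultimately show ?thesis
    using F that by blast
qed

lemma nowhere_dense_in_hausdorff_topology_hitting_iff:
  fixes S :: "'a::metric_space set"
  assumes "A \<subseteq> S"
  shows "nowhere_dense_in (hausdorff_topology S) {E \<in> compacts_in S. E \<inter> A \<noteq> {}} \<longleftrightarrow>
         nowhere_dense_in (top_of_set S) A" (is "?K \<longleftrightarrow> ?A")
proof
  assume K: ?K
  show ?A
    unfolding nowhere_dense_in_top_of_set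
  proof (intro conjI assms ballI allI impI)
    fix x and r :: real assume x: "x \<in> S" and "0 < r"
    \<comment> \<open>Points are tested through singletons: a compact set within \<open>r\<close> of
      \<open>{x}\<close> has all its points within \<open>r\<close> of \<open>x\<close>.\<close>
    have x': "{x} \<in> compacts_in S"
      using x by (simp add: compacts_in_def)
    have "\<exists>F\<in>compacts_in S. hausdorff_dist {x} F < r \<and>
        (\<exists>s>0. \<forall>G\<in>compacts_in S. hausdorff_dist F G < s \<longrightarrow>
          G \<notin> {E \<in> compacts_in S. E \<inter> A \<noteq> {}})"
      using K x' \<open>0 < r\<close> unfolding nowhere_dense_in_hausdorff_topology by simp
    then obtain F s where F: "F \<in> compacts_in S" "hausdorff_dist {x} F < r" and "0 < s"
      and miss: "\<And>G. G \<in> compacts_in S \<Longrightarrow> hausdorff_dist F G < s \<Longrightarrow> G \<inter> A = {}"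
      by auto
    note F' = compacts_in_imp_compacts_in_UNIV[OF F(1)]
    obtain f where f: "f \<in> F" "f \<in> S"
      using F(1) by (auto simp: compacts_in_def)
    have "f \<in> open_thickening {x} r"
      using hausdorff_dist_less_imp(2)[OF compacts_in_imp_compacts_in_UNIV[OF x'] F' F(2)] f by blast
    then have "dist x f < r"
      by (auto elim: in_open_thickeningE simp: dist_commute)
    moreover have "a \<notin> A" if a: "a \<in> S" "dist f a < s" for a
    proof -
      \<comment> \<open>The intermediate \<open>t\<close> is needed because the insertion bound is
        only \<open>\<le> t\<close>, while \<open>miss\<close> requires a distance strictly below
        \<open>s\<close>.\<close>
      obtain t where t: "dist f a < t" "t < s"
        using a dense by blast
      have "insert a F \<in> compacts_in S"
        using F(1) a by (simp add: compacts_in_def)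
      moreover have "hausdorff_dist F (insert a F) < s"
        using hausdorff_dist_insert_le[OF F' f(1) t(1)] t(2) by simp
      ultimately show ?thesis
        using miss by blast
    qed
    ultimately show "\<exists>y\<in>S. dist x y < r \<and> (\<exists>s>0. S \<inter> ball y s \<inter> A = {})"
      using f \<open>0 < s\<close> by (intro bexI[of _ f] conjI exI[of _ s]) auto
  qed
next
  assume A: ?A
  show ?K
    unfolding nowhere_dense_in_hausdorff_topology
  proof (intro conjI ballI allI impI)
    fix E and r :: real assume "E \<in> compacts_in S" "0 < r"
    then obtain F s where F: "F \<in> compacts_in S" "hausdorff_dist E F < r" "0 < s"
      and miss: "\<And>f. f \<in> F \<Longrightarrow> S \<inter> ball f s \<inter> A = {}"
      using compact_imp_finite_approximation_avoiding[OF A] by metis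
    \<comment> \<open>Each point of such a \<open>G\<close> lies in \<open>ball f s\<close> for some
      \<open>f \<in> F\<close>, and these balls miss \<open>A\<close> within
      \<open>S\<close>.\<close>
    have "G \<inter> A = {}" if G: "G \<in> compacts_in S" "hausdorff_dist F G < s" for G
    proof -
      have "G \<subseteq> open_thickening F s"
        using hausdorff_dist_less_imp(2) F(1) G compacts_in_imp_compacts_in_UNIV by blast
      moreover have "F \<noteq> {}" "G \<subseteq> S"
        using F(1) G(1) by (auto simp: compacts_in_def)
      ultimately show ?thesis
        using miss by (fastforce elim: in_open_thickeningE simp: dist_commute)
    qed
    then show "\<exists>F\<in>compacts_in S. hausdorff_dist E F < r \<and>
        (\<exists>s>0. \<forall>G\<in>compacts_in S. hausdorff_dist F G < s \<longrightarrow>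
          G \<notin> {E \<in> compacts_in S. E \<inter> A \<noteq> {}})"
      using F by blast
  qed auto
qed

text \<open>Here \<open>0\<close> and \<open>1\<close> are constant vectors, so
  \<open>cbox 0 1\<close> is the unit cube; the dimension is the size of the finite type
  \<open>'n\<close>, hence at least one.\<close>

theorem theorem1p3:
  fixes A :: "(real ^ 'n) set"
  assumes "A \<subseteq> cbox 0 1"
  shows "nowhere_dense_in (top_of_set (cbox 0 1)) A \<longleftrightarrow>
         nowhere_dense_in (hausdorff_topology (cbox 0 1))
           {E \<in> compacts_in (cbox 0 1). E \<inter> A \<noteq> {}}"
  using nowhere_dense_in_hausdorff_topology_hitting_iff[OF assms] by simp

end
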